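(* For a given admission price pair $(c_1,c_2)$, there exists a unique Nash equilibrium of the secondary users' joining probability $(p_1^*,p_2^* )$ in the duopoly market, i.e. (with $\epsilon>0$ sufficiently small and all notation as in the context) a unique pair $(p_1^*,p_2^* )$ satisfying $$(p_1^*,p_2^* )=\begin{cases}\bigl(0,\;F_\Theta(\theta_2^* )\bigr), & \text{if }\bar\theta(p^\epsilon)<0,\\ \bigl(F_\Theta(\bar\theta(p_1^* )),\;F_\Theta(\theta_2^* )-F_\Theta(\bar\theta(p_1^* ))\bigr), & \text{if }0<\bar\theta(p^\epsilon)<\theta_2^*,\\ \bigl(F_\Theta(\theta_1(p_1^* )),\;0\bigr), & \text{if }\bar\theta(p^\epsilon)>\theta_2^*,\end{cases}$$ where $$\theta_1(p)=\frac{V-c_1}{\mathbf{E}[T(p)]},\qquad \theta_2^*=\frac{V-c_2}{\mathbf{E}[X]},\qquad \bar\theta(p)=\frac{c_2-c_1}{\mathbf{E}[T(p)]-\mathbf{E}[X]},\qquad p^\epsilon=\min\Bigl\{1,\tfrac{1}{\lambda\mathbf{E}[X_e]}-\epsilon\Bigr\}.$$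
   Context: Secondary users (SUs) arrive according to a Poisson process of rate $\lambda$. Each SU carries a job with random service time $X$, independent of the arrival process. Its type $\theta$ (delay sensitivity) is drawn from the uniform distribution on $[0,\theta_{\mathrm{up}}]$, with cumulative distribution function $F_\Theta$ (so $F_\Theta(x)=0$ for $x\le 0$, $F_\Theta(x)=x/\theta_{\mathrm{up}}$ on $[0,\theta_{\mathrm{up}}]$, and $F_\Theta(x)=1$ for $x\ge\theta_{\mathrm{up}}$). $V$ is the reward an SU gets from being served. Two operators are present: a shared-use operator with admission price $c_1$ and an exclusive-use operator with admission price $c_2$. The shared-use operator has a single channel alternating between ON periods (i.i.d. copies $Y_i$ of a random variable $Y$, during which SU service is interrupted) and OFF periods (i.i.d. copies of a random variable $Z$), independent of SU arrivals and service times. The effective service time is $X_e=X+\sum_{i=1}^{N(X)}Y_i$, where $N(X)$ is the number of ON periods interrupting the service; $\mathbf{E}[X_e]=\mathbf{E}[X]\,(1+\mathbf{E}[Y]/\mathbf{E}[Z])$. If a fraction $p\in[0,1]$ of SUs joins the shared-use operator, its mean queueing delay (M/G/1 queue with arrival rate $\lambda p$ and service time $X_e$) is $$\mathbf{E}[T(p)]=\begin{cases}\dfrac{\lambda p\,\mathbf{E}[X_e^2]}{2(1-\lambda p\,\mathbf{E}[X_e])}+\mathbf{E}[X_e], & \lambda p<1/\mathbf{E}[X_e],\\[2mm] \infty, & \text{otherwise.}\end{cases}$$ The exclusive-use operator's mean delay is always $\mathbf{E}[X]$. A type-$\theta$ SU has utility $U_1(\theta)=V-\theta\,\mathbf{E}[T(p_1)]-c_1$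 with the shared-use operator, $U_2(\theta)=V-\theta\,\mathbf{E}[X]-c_2$ with the exclusive-use operator, and $0$ if it balks. It joins the shared-use operator if $U_1(\theta)>U_2(\theta)$ and $U_1(\theta)>0$, joins the exclusive-use operator if $U_2(\theta)>U_1(\theta)$ and $U_2(\theta)>0$, and joins neither if both utilities are negative. Here $p_1$ and $p_2$ are the fractions of SUs joining the shared-use and exclusive-use operators, respectively. Given a sufficiently small $\epsilon$, a Nash equilibrium of the SUs' joining probability in the duopoly market is defined to be a pair $(p_1^*,p_2^* )$ satisfying the displayed case equation.
   Formalization: The displayed cases leave ties uncovered (e.g. equal prices c_1=c_2<V, where no case applies); here the first case is taken with θ̄(p^ε) ≤ 0 and the third with θ̄(p^ε) ≥ θ_2^*, so every price pair is covered. Where cases one and three overlap, both equations are required. *)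

theory Defs
  imports "HOL-Probability.Probability"
begin

text \<open>
  The k-th ON period (k = 1, 2, ...) interrupts a service once the amount of service given
  exceeds \<open>R + Z 1 + ... + Z (k - 1)\<close>: \<open>R\<close> is the part of the current OFF period that is left
  when the service starts. Its law is not fixed, so that no assumption is made on the phase of the
  channel at the start of a service. An ON period beginning exactly at completion of the service
  does not interrupt it.
\<close>

definition num_interruptions ::
    "('a \<Rightarrow> real) \<Rightarrow> (nat \<Rightarrow> 'a \<Rightarrow> real) \<Rightarrow> real \<Rightarrow> 'a \<Rightarrow> nat" where
  "num_interruptions R Zs x \<omega> = card {k. 1 \<le> k \<and> R \<omega> + (\<Sum>i = 1..<k. Zs i \<omega>) < x}"

definition effective_service ::
    "('a \<Rightarrow> real) \<Rightarrow> ('a \<Rightarrow> real) \<Rightarrow> (nat \<Rightarrow> 'a \<Rightarrow> real) \<Rightarrow> (nat \<Rightarrow> 'a \<Rightarrow> real) \<Rightarrow> 'a \<Rightarrow> real"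
  where
  "effective_service X R Ys Zs \<omega> =
     X \<omega> + (\<Sum>i = 1..num_interruptions R Zs (X \<omega>) \<omega>. Ys i \<omega>)"

text \<open>
  The Poisson arrivals enter the model only through their rate \<open>lam\<close> in the mean delay.
  The formula for the mean of the effective service time is a standing assumption; it holds, for
  instance, if \<open>R\<close>, the OFF periods and the ON periods are independent and \<open>R\<close> has the stationary
  residual law of \<open>Z\<close> (the law of \<open>Z\<close> itself if \<open>Z\<close> is exponential). A finite second moment of
  the effective service time is what makes the mean M/G/1 delay finite below saturation.
\<close>

locale duopoly_market = prob_space M for M :: "'a measure" +
  fixes lam :: real
    and theta_up :: real
    and X :: "'a \<Rightarrow> real"
    and Y :: "'a \<Rightarrow> real"
    and Z :: "'a \<Rightarrow> real"
    and R :: "'a \<Rightarrow> real"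
    and Ys :: "nat \<Rightarrow> 'a \<Rightarrow> real"
    and Zs :: "nat \<Rightarrow> 'a \<Rightarrow> real"
  assumes lam_pos: "lam > 0"
    and theta_up_pos: "theta_up > 0"
    and X_integrable: "integrable M X" and X_nonneg: "AE \<omega> in M. 0 \<le> X \<omega>"
    and X_mean_pos: "expectation X > 0"
    and Y_integrable: "integrable M Y" and Y_nonneg: "AE \<omega> in M. 0 \<le> Y \<omega>"
    and Y_mean_pos: "expectation Y > 0"
    and Z_integrable: "integrable M Z" and Z_nonneg: "AE \<omega> in M. 0 \<le> Z \<omega>"
    and Z_mean_pos: "expectation Z > 0"
    and R_measurable: "random_variable borel R" and R_nonneg: "AE \<omega> in M. 0 \<le> R \<omega>"
    and Ys_indep: "indep_vars (\<lambda>_. borel) Ys UNIV"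
    and Ys_distr: "\<And>i. distr M borel (Ys i) = distr M borel Y"
    and Zs_indep: "indep_vars (\<lambda>_. borel) Zs UNIV"
    and Zs_distr: "\<And>i. distr M borel (Zs i) = distr M borel Z"
    and X_indep_channel:
      "indep_set (sets (vimage_algebra (space M) X borel))
         (sets (vimage_algebra (space M) (\<lambda>\<omega>. (R \<omega>, \<lambda>i. (Ys i \<omega>, Zs i \<omega>)))
            (borel \<Otimes>\<^sub>M (\<Pi>\<^sub>M i\<in>UNIV. borel \<Otimes>\<^sub>M borel))))"
    and Xe_square_integrable: "integrable M (\<lambda>\<omega>. (effective_service X R Ys Zs \<omega>)\<^sup>2)"
    and Xe_mean: "expectation (effective_service X R Ys Zs) =
      expectation X * (1 + expectation Y / expectation Z)"
begin

definition F_Theta :: "real \<Rightarrow> real" where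
  "F_Theta = cdf (uniform_measure lborel {0..theta_up})"

abbreviation Xe :: "'a \<Rightarrow> real" where
  "Xe \<equiv> effective_service X R Ys Zs"

definition mean_delay :: "real \<Rightarrow> ereal" where
  "mean_delay p =
     (if lam * p < 1 / expectation Xe
      then ereal (lam * p * expectation (\<lambda>\<omega>. (Xe \<omega>)\<^sup>2) / (2 * (1 - lam * p * expectation Xe))
             + expectation Xe)
      else \<infinity>)"

text \<open>A real number divided by an infinite delay is 0 in \<open>ereal\<close>.\<close>

definition theta1 :: "real \<Rightarrow> real \<Rightarrow> real \<Rightarrow> real" where
  "theta1 V c1 p = real_of_ereal (ereal (V - c1) / mean_delay p)"

definition theta2 :: "real \<Rightarrow> real \<Rightarrow> real" where
  "theta2 V c2 = (V - c2) / expectation X"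

definition theta_bar :: "real \<Rightarrow> real \<Rightarrow> real \<Rightarrow> real" where
  "theta_bar c1 c2 p = real_of_ereal (ereal (c2 - c1) / (mean_delay p - ereal (expectation X)))"

definition p_eps :: "real \<Rightarrow> real" where
  "p_eps \<epsilon> = min 1 (1 / (lam * expectation Xe) - \<epsilon>)"

text \<open>
  The usual case distinction has strict inequalities in all three cases. The ties are added to the
  first and third cases so that every price pair is covered. For \<open>theta_bar = 0\<close> (equal prices) the
  formula of the second case gives the same pair as the first. For \<open>theta_bar = theta2 > 0\<close> the
  third case is the one in agreement with the joining rule: its solution has \<open>p1 \<le> p_eps \<epsilon>\<close>
  (for small \<open>\<epsilon>\<close>), so no type strictly prefers the exclusive-use operator to both alternatives.
  The first and third conditions can hold together (only if \<open>V \<le> c2 \<le> c1\<close>, for small \<open>\<epsilon>\<close>); both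
  equations are then required. The second component is a real number that the equations do not
  force to be nonnegative.
\<close>

definition nash_equilibrium ::
    "real \<Rightarrow> real \<Rightarrow> real \<Rightarrow> real \<Rightarrow> real \<times> real \<Rightarrow> bool" where
  "nash_equilibrium V \<epsilon> c1 c2 = (\<lambda>(p1, p2).
     (theta_bar c1 c2 (p_eps \<epsilon>) \<le> 0 \<longrightarrow>
        (p1, p2) = (0, F_Theta (theta2 V c2))) \<and>
     (0 < theta_bar c1 c2 (p_eps \<epsilon>) \<and> theta_bar c1 c2 (p_eps \<epsilon>) < theta2 V c2 \<longrightarrow>
        (p1, p2) = (F_Theta (theta_bar c1 c2 p1),
                    F_Theta (theta2 V c2) - F_Theta (theta_bar c1 c2 p1))) \<and>
     (theta_bar c1 c2 (p_eps \<epsilon>) \<ge> theta2 V c2 \<longrightarrow>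
        (p1, p2) = (F_Theta (theta1 V c1 p1), 0)))"

end

end

theory Submission
  imports Defs
begin

text \<open>
  The mean delay is increasing in the joining fraction, so each of the two implicit equations
  \<open>p\<^sub>1 = F_Theta (K / (mean_delay p\<^sub>1 - d))\<close> with \<open>K \<ge> 0\<close> equates the identity with a continuous
  antitone map of \<open>[0, 1]\<close> into itself, which has exactly one fixed point; for \<open>K \<le> 0\<close> the right-hand
  side vanishes. Once \<open>p_eps \<epsilon>\<close> lies strictly between 0 and the saturation point, the sign of
  \<open>theta_bar c1 c2 (p_eps \<epsilon>)\<close> is that of \<open>c2 - c1\<close>, so the first and third cases overlap only if
  \<open>V \<le> c2 \<le> c1\<close>, where both force \<open>(0, 0)\<close>.
\<close>

section \<open>Fixed points of antitone maps\<close>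

lemma ex1_fixpoint_antimono:
  fixes f :: "real \<Rightarrow> real"
  assumes range: "\<And>x. f x \<in> {a..b}"
    and cont: "continuous_on {a..b} f"
    and anti: "\<And>x y. a \<le> x \<Longrightarrow> x \<le> y \<Longrightarrow> f y \<le> f x"
  shows "\<exists>!x. x = f x"
proof (rule ex_ex1I)
  have "a \<le> b" using range[of a] by auto
  moreover have "continuous_on {a..b} (\<lambda>x. x - f x)"
    by (intro continuous_intros cont)
  moreover have "a - f a \<le> 0" "0 \<le> b - f b" using range[of a] range[of b] by auto
  ultimately obtain x where "x - f x = 0"
    using IVT'[of "\<lambda>x. x - f x" a 0 b] by blast
  then show "\<exists>x. x = f x" by (intro exI[of _ x]) simp
next
  fix x y assume "x = f x" "y = f y"
  \<comment> \<open>\<open>range\<close> holds on the whole line and so puts every fixed point in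
    \<open>{a..b}\<close>; antitonicity from \<open>a\<close> on then gives uniqueness among all
    reals.\<close>
  moreover from this have "a \<le> x" "a \<le> y" using range[of x] range[of y] by auto
  ultimately show "x = y" using anti[of x y] anti[of y x] by linarith
qed

context duopoly_market
begin

section \<open>Distribution of types and moments of the effective service time\<close>

lemma F_Theta_eq: "F_Theta x = max 0 (min x theta_up) / theta_up"
proof -
  have "{0..theta_up} \<inter> {..x} = {0..min x theta_up}" by auto
  then show ?thesis
    using theta_up_pos by (simp add: F_Theta_def cdf_def measure_uniform_measure max_def min.commute)
qed

lemma F_Theta_range: "F_Theta x \<in> {0..1}"
  using theta_up_pos by (auto simp: F_Theta_eq divide_simps)

lemma F_Theta_nonpos: "x \<le> 0 \<Longrightarrow> F_Theta x = 0"
  using theta_up_pos by (simp add: F_Theta_eq)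

lemma F_Theta_mono: "x \<le> y \<Longrightarrow> F_Theta x \<le> F_Theta y"
  using theta_up_pos by (auto simp: F_Theta_eq intro!: divide_right_mono)

lemma continuous_on_F_Theta [continuous_intros]:
  "continuous_on A f \<Longrightarrow> continuous_on A (\<lambda>x. F_Theta (f x))"
  using theta_up_pos unfolding F_Theta_eq by (intro continuous_intros) auto

lemma mean_X_less_mean_Xe: "expectation X < expectation Xe"
  using X_mean_pos Y_mean_pos Z_mean_pos by (simp add: Xe_mean algebra_simps)

lemma mean_Xe_pos: "expectation Xe > 0"
  using mean_X_less_mean_Xe X_mean_pos by simp

text \<open>A null second moment would force \<open>Xe\<close> to vanish almost everywhere, against
  its positive mean. Strict positivity keeps the denominator of \<open>inv_excess\<close> away from
  0 under saturation.\<close>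

lemma second_moment_Xe_pos: "expectation (\<lambda>\<omega>. (Xe \<omega>)\<^sup>2) > 0"
proof -
  have "expectation (\<lambda>\<omega>. (Xe \<omega>)\<^sup>2) \<noteq> 0"
  proof
    assume "expectation (\<lambda>\<omega>. (Xe \<omega>)\<^sup>2) = 0"
    then have "AE \<omega> in M. (Xe \<omega>)\<^sup>2 = 0"
      using integral_nonneg_eq_0_iff_AE[OF Xe_square_integrable] by simp
    then have "AE \<omega> in M. Xe \<omega> = 0" by simp
    then have "expectation Xe = 0" by (rule integral_eq_zero_AE)
    then show False using mean_Xe_pos by simp
  qed
  moreover have "expectation (\<lambda>\<omega>. (Xe \<omega>)\<^sup>2) \<ge> 0" by simp
  ultimately show ?thesis by linarith
qed

section \<open>Reciprocal of the delay\<close>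

text \<open>The probability that an M/G/1 server is idle, 1 minus the load. The cut at 0 makes
  \<open>inv_excess\<close> vanish from saturation on, as the reciprocal of an infinite delay
  does.\<close>

definition idle_prob :: "real \<Rightarrow> real" where
  "idle_prob p = max 0 (1 - lam * p * expectation Xe)"

text \<open>\<open>1 / (mean_delay p - d)\<close>, cleared of the inner fraction so that saturation is no exception.\<close>

definition inv_excess :: "real \<Rightarrow> real \<Rightarrow> real" where
  "inv_excess d p = 2 * idle_prob p /
     (lam * p * expectation (\<lambda>\<omega>. (Xe \<omega>)\<^sup>2) + 2 * idle_prob p * (expectation Xe - d))"

text \<open>The summands take turns: for \<open>p = 0\<close> the idle probability is 1, and for
  \<open>p > 0\<close> the second-moment term is positive even when the other one is 0.\<close>

lemma inv_excess_denominator_pos: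
  assumes "0 \<le> p" "d < expectation Xe"
  shows "0 < lam * p * expectation (\<lambda>\<omega>. (Xe \<omega>)\<^sup>2) + 2 * idle_prob p * (expectation Xe - d)"
proof (cases "p = 0")
  case True
  then show ?thesis using assms by (simp add: idle_prob_def)
next
  case False
  then have "0 < lam * p * expectation (\<lambda>\<omega>. (Xe \<omega>)\<^sup>2)"
    using assms lam_pos second_moment_Xe_pos by simp
  moreover have "0 \<le> 2 * idle_prob p * (expectation Xe - d)"
    using assms by (simp add: idle_prob_def)
  ultimately show ?thesis by linarith
qed

lemma inv_excess_pos:
  assumes "0 \<le> p" "lam * p < 1 / expectation Xe" "d < expectation Xe"
  shows "0 < inv_excess d p"
proof -
  have "0 < idle_prob p"
    using assms mean_Xe_pos by (simp add: idle_prob_def field_simps)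
  then show ?thesis
    using inv_excess_denominator_pos[OF assms(1,3)] by (simp add: inv_excess_def)
qed

lemma inv_excess_nonneg:
  "0 \<le> p \<Longrightarrow> d < expectation Xe \<Longrightarrow> 0 \<le> inv_excess d p"
  using inv_excess_denominator_pos[of p d] by (simp add: inv_excess_def idle_prob_def)

lemma inv_excess_antimono:
  assumes "0 \<le> p" "p \<le> q" and d: "d < expectation Xe"
  shows "inv_excess d q \<le> inv_excess d p"
proof -
  let ?S = "expectation (\<lambda>\<omega>. (Xe \<omega>)\<^sup>2)"
  have "lam * p * expectation Xe \<le> lam * q * expectation Xe"
    using assms lam_pos mean_Xe_pos by simp
  then have idle: "0 \<le> idle_prob q" "idle_prob q \<le> idle_prob p"
    unfolding idle_prob_def by linarith+
  have "lam * p * ?S \<le> lam * q * ?S"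
    using assms lam_pos second_moment_Xe_pos by simp
  moreover have "0 \<le> lam * p * ?S"
    using assms lam_pos second_moment_Xe_pos by simp
  ultimately have "idle_prob q * (lam * p * ?S) \<le> idle_prob p * (lam * q * ?S)"
    using idle by (simp only: mult_mono)
  \<comment> \<open>The goal cross-multiplied: the term with both idle probabilities occurs on
    either side and cancels, which leaves the inequality just shown.\<close>
  then have "2 * idle_prob q * (lam * p * ?S + 2 * idle_prob p * (expectation Xe - d))
      \<le> 2 * idle_prob p * (lam * q * ?S + 2 * idle_prob q * (expectation Xe - d))"
    by (simp add: algebra_simps)
  moreover have "a / b \<le> c / e" if "0 < b" "0 < e" "a * e \<le> c * b" for a b c e :: real
    using that by (simp add: field_simps)
  ultimately show ?thesis
    unfolding inv_excess_def
    using inv_excess_denominator_pos[of p d] inv_excess_denominator_pos[of q d] assms by simp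
qed

lemma continuous_on_inv_excess:
  assumes "d < expectation Xe"
  shows "continuous_on {0..b} (inv_excess d)"
proof -
  have "continuous_on {0..b} idle_prob"
    unfolding idle_prob_def by (intro continuous_intros)
  then show ?thesis
    unfolding inv_excess_def using inv_excess_denominator_pos[OF _ assms]
    by (intro continuous_intros) (auto simp: less_imp_neq[symmetric])
qed

lemma divide_mean_delay_eq:
  assumes "0 \<le> p" "d < expectation Xe"
  shows "real_of_ereal (ereal K / (mean_delay p - ereal d)) = K * inv_excess d p"
proof (cases "lam * p < 1 / expectation Xe")
  case True
  let ?S = "expectation (\<lambda>\<omega>. (Xe \<omega>)\<^sup>2)" and ?m = "expectation Xe"
  let ?w = "1 - lam * p * ?m"
  have w: "0 < ?w" using True mean_Xe_pos by (simp add: field_simps)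
  then have idle: "idle_prob p = ?w" by (simp add: idle_prob_def)
  let ?E = "lam * p * ?S / (2 * ?w) + ?m - d"
  have E: "?E = (lam * p * ?S + 2 * ?w * (?m - d)) / (2 * ?w)"
    using w by (simp only: add_divide_distrib) simp
  have "0 < ?E"
    unfolding E using inv_excess_denominator_pos[OF assms] w by (simp only: idle) simp
  then have "real_of_ereal (ereal K / (mean_delay p - ereal d)) = K / ?E"
    using True by (simp add: mean_delay_def)
  also have "\<dots> = K * inv_excess d p"
    unfolding E inv_excess_def idle by simp
  finally show ?thesis .
next
  case False
  \<comment> \<open>At saturation the delay is infinite, so the \<open>ereal\<close> quotient is 0,
    and so is \<open>inv_excess\<close>.\<close>
  then have "idle_prob p = 0"
    using mean_Xe_pos by (simp add: idle_prob_def field_simps)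
  with False show ?thesis by (simp add: mean_delay_def inv_excess_def)
qed

section \<open>Thresholds and joining fractions\<close>

lemma theta_bar_eq:
  "0 \<le> p \<Longrightarrow> theta_bar c1 c2 p = (c2 - c1) * inv_excess (expectation X) p"
  by (simp add: theta_bar_def divide_mean_delay_eq mean_X_less_mean_Xe)

lemma theta1_eq: "0 \<le> p \<Longrightarrow> theta1 V c1 p = (V - c1) * inv_excess 0 p"
  using divide_mean_delay_eq[of p 0 "V - c1"] mean_Xe_pos
  by (simp add: theta1_def flip: zero_ereal_def)

text \<open>Serves both implicit equations: \<open>d\<close> is \<open>expectation X\<close> for
  \<open>theta_bar\<close> and 0 for \<open>theta1\<close>. A formula for \<open>p \<ge> 0\<close>
  suffices, since \<open>F_Theta\<close> has values in [0, 1].\<close>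

lemma ex1_joining_fraction:
  assumes d: "d < expectation Xe"
    and \<theta>: "\<And>p. 0 \<le> p \<Longrightarrow> \<theta> p = K * inv_excess d p"
  shows "\<exists>!p. p = F_Theta (\<theta> p)"
proof (rule ex1_fixpoint_antimono[where a = 0 and b = 1])
  show "F_Theta (\<theta> p) \<in> {0..1}" for p by (rule F_Theta_range)
  have "continuous_on {0..1} (\<lambda>p. F_Theta (K * inv_excess d p))"
    by (intro continuous_intros continuous_on_inv_excess d)
  then show "continuous_on {0..1} (\<lambda>p. F_Theta (\<theta> p))"
    by (rule continuous_on_eq) (simp add: \<theta>)
  show "F_Theta (\<theta> q) \<le> F_Theta (\<theta> p)" if "0 \<le> p" "p \<le> q" for p q
  proof (cases "0 \<le> K")
    case True
    then have "\<theta> q \<le> \<theta> p"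
      using that inv_excess_antimono[OF that d] by (simp add: \<theta> mult_left_mono)
    then show ?thesis by (rule F_Theta_mono)
  next
    \<comment> \<open>For negative \<open>K\<close> the threshold itself is increasing, but it stays
      nonpositive, where \<open>F_Theta\<close> is 0.\<close>
    case False
    then have "\<theta> q \<le> 0"
      using that inv_excess_nonneg[OF _ d, of q] by (simp add: \<theta> mult_nonpos_nonneg)
    then show ?thesis using F_Theta_range[of "\<theta> p"] by (simp add: F_Theta_nonpos)
  qed
qed

lemma ex1_theta_bar_fraction: "\<exists>!p. p = F_Theta (theta_bar c1 c2 p)"
  by (rule ex1_joining_fraction[OF mean_X_less_mean_Xe theta_bar_eq])

lemma ex1_theta1_fraction: "\<exists>!p. p = F_Theta (theta1 V c1 p)"
  by (rule ex1_joining_fraction[OF mean_Xe_pos theta1_eq])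

section \<open>Case analysis for the equilibrium\<close>

lemma theta_bar_p_eps_pos_iff:
  assumes "0 < \<epsilon>" "\<epsilon> < 1 / (lam * expectation Xe)"
  shows "0 < theta_bar c1 c2 (p_eps \<epsilon>) \<longleftrightarrow> c1 < c2"
proof -
  \<comment> \<open>The upper bound on \<epsilon> gives nonnegativity; its positivity keeps
    \<open>p_eps \<epsilon>\<close> strictly below saturation.\<close>
  have nonneg: "0 \<le> p_eps \<epsilon>" using assms by (simp add: p_eps_def)
  have "p_eps \<epsilon> < 1 / (lam * expectation Xe)" using assms by (simp add: p_eps_def)
  then have "lam * p_eps \<epsilon> < 1 / expectation Xe"
    using lam_pos mean_Xe_pos by (simp add: field_simps)
  then have "0 < inv_excess (expectation X) (p_eps \<epsilon>)"
    using nonneg mean_X_less_mean_Xe by (intro inv_excess_pos)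
  then show ?thesis using nonneg by (simp add: theta_bar_eq zero_less_mult_iff)
qed

lemma ex1_nash_equilibrium:
  assumes \<epsilon>: "0 < \<epsilon>" "\<epsilon> < 1 / (lam * expectation Xe)"
  shows "\<exists>!p. nash_equilibrium V \<epsilon> c1 c2 p"
proof -
  let ?t = "theta_bar c1 c2 (p_eps \<epsilon>)"
  consider (exclusive) "?t \<le> 0" | (both) "0 < ?t" "?t < theta2 V c2"
    | (shared) "0 < ?t" "theta2 V c2 \<le> ?t" by linarith
  then show ?thesis
  proof cases
    case exclusive
    then have c: "c2 \<le> c1" using theta_bar_p_eps_pos_iff[OF \<epsilon>, of c1 c2] by linarith
    \<comment> \<open>If the third condition holds as well, the pair of the first case has to solve
      the third equation too.\<close>
    have "0 = F_Theta (theta1 V c1 0) \<and> F_Theta (theta2 V c2) = 0" if "theta2 V c2 \<le> ?t"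
    proof -
      have le: "theta2 V c2 \<le> 0" using that exclusive by linarith
      then have "V \<le> c2" using X_mean_pos by (simp add: theta2_def divide_le_0_iff)
      then have "theta1 V c1 0 \<le> 0"
        using c inv_excess_nonneg[of 0 0] mean_Xe_pos
        by (simp add: theta1_eq mult_nonpos_nonneg)
      then show ?thesis using le by (simp add: F_Theta_nonpos)
    qed
    then have "nash_equilibrium V \<epsilon> c1 c2 (0, F_Theta (theta2 V c2))"
      using exclusive by (auto simp: nash_equilibrium_def)
    moreover have "p = (0, F_Theta (theta2 V c2))" if "nash_equilibrium V \<epsilon> c1 c2 p" for p
      using that exclusive by (auto simp: nash_equilibrium_def)
    ultimately show ?thesis by blast
  next
    case both
    then have "nash_equilibrium V \<epsilon> c1 c2 (p1, p2) \<longleftrightarrow> p1 = F_Theta (theta_bar c1 c2 p1) \<and>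
        p2 = F_Theta (theta2 V c2) - F_Theta (theta_bar c1 c2 p1)" for p1 p2
      by (auto simp: nash_equilibrium_def)
    \<comment> \<open>The second component is a function of the first, so only \<open>p1\<close> has
      to be unique.\<close>
    then show ?thesis using ex1_theta_bar_fraction[of c1 c2] by (auto simp: Ex1_def)
  next
    case shared
    then have "nash_equilibrium V \<epsilon> c1 c2 (p1, p2) \<longleftrightarrow> p1 = F_Theta (theta1 V c1 p1) \<and> p2 = 0"
      for p1 p2
      by (auto simp: nash_equilibrium_def)
    then show ?thesis using ex1_theta1_fraction[of V c1] by (auto simp: Ex1_def)
  qed
qed

end

theorem theorem3:
  fixes M :: "'a measure"
    and lam theta_up V :: real
    and X Y Z R :: "'a \<Rightarrow> real"
    and Ys Zs :: "nat \<Rightarrow> 'a \<Rightarrow> real"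
  assumes "duopoly_market M lam theta_up X Y Z R Ys Zs"
  shows "\<forall>\<^sub>F \<epsilon> in at_right (0::real). \<forall>c1 c2 :: real. \<exists>!p :: real \<times> real.
           duopoly_market.nash_equilibrium M lam theta_up X R Ys Zs V \<epsilon> c1 c2 p"
proof -
  interpret duopoly_market M lam theta_up X Y Z R Ys Zs by fact
  \<comment> \<open>This threshold for \<epsilon> depends on neither price, so one neighbourhood of
    0 serves all price pairs at once.\<close>
  have "0 < 1 / (lam * expectation Xe)" using lam_pos mean_Xe_pos by simp
  then show ?thesis
    unfolding eventually_at_right_field using ex1_nash_equilibrium by blast
qed

end
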